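(* For each $n$ let $U\in\mathbb C^{n\times n}$ be a unitary matrix such that the products of $U$ and of $U^*$ with an arbitrary vector can be computed in $O(n\log n)$ arithmetic operations. Let $W=U\,\mathrm{diag}(\lambda_1(W),\dots,\lambda_n(W))\,U^*$ be non-derogatory (i.e. $\lambda_i(W)=\lambda_k(W)$ if and only if $i=k$), so that the algebra $\mathscr A(W)$ generated by $W$ equals $\{U\,\mathrm{diag}(\theta_1,\dots,\theta_n)\,U^*\mid \theta_i\in\mathbb C\}$, and assume that the numbers $\lambda_1(W),\dots,\lambda_n(W)$ are explicitly known. Let $A\in\mathbb C^{n\times n}$ be such that $\mathrm{rank}\,[A,W]=\rho$ with $\rho$ uniformly bounded in $n$, and assume a dyadic decomposition $[A,W]=\sum_{k=1}^{\rho}x_ky_k^*$ is known. Then, after a preprocessing phase of $O(n\log n)$ arithmetic operations (not depending on the entry requested) which computes data determining $U^*[A,W]U$, each off-diagonal entry $(U^*AU)_{ij}$, $i\neq j$, can be calculated with $\rho+1$ multiplicative operations (multiplications or divisions).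
   Context: $[A,W]=AW-WA$ is the commutator. $\mathscr A(W)=\{p(W)\mid p\text{ a polynomial}\}$ is the algebra generated by $W$. $\lambda_i(W)$ denotes the eigenvalue of $W$ associated with the $i$-th column of $U$. A normal matrix is non-derogatory when its eigenvalues are pairwise distinct. Complexity is measured by the number of arithmetic operations on complex numbers (complex conjugation is free); a division counts as one multiplicative operation, and additions/subtractions are not counted among multiplicative operations. The constants in $O(\cdot)$ are independent of $n$. *)

theory Defs
  imports
    "HOL-Library.Landau_Symbols"
    "Jordan_Normal_Form.Schur_Decomposition"
    "Jordan_Normal_Form.DL_Rank"
begin

section \<open>Straight-line programs over the complex numbers\<close>

text \<open>
  The registers of a program form a list that initially holds the input; the operands of an
  instruction are positions in this list, and every instruction appends its result to it.
  A program fails (result \<^term>\<open>None\<close>) if it divides by zero or reads a register that does not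
  exist yet, so the convention \<open>z / 0 = 0\<close> cannot be exploited as a free test for zero.
  \<open>CConst\<close> loads a constant that belongs to the program and hence cannot depend on the input.
\<close>

datatype instr =
    CConst complex
  | CConj nat
  | CAdd nat nat
  | CSub nat nat
  | CMul nat nat
  | CDiv nat nat

fun exec_instr :: "complex list \<Rightarrow> instr \<Rightarrow> complex option" where
  "exec_instr r (CConst c) = Some c"
| "exec_instr r (CConj a) = (if a < length r then Some (cnj (r ! a)) else None)"
| "exec_instr r (CAdd a b) =
     (if a < length r \<and> b < length r then Some (r ! a + r ! b) else None)"
| "exec_instr r (CSub a b) =
     (if a < length r \<and> b < length r then Some (r ! a - r ! b) else None)"
| "exec_instr r (CMul a b) =
     (if a < length r \<and> b < length r then Some (r ! a * r ! b) else None)"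
| "exec_instr r (CDiv a b) =
     (if a < length r \<and> b < length r \<and> r ! b \<noteq> 0 then Some (r ! a / r ! b) else None)"

fun exec :: "complex list \<Rightarrow> instr list \<Rightarrow> complex list option" where
  "exec r [] = Some r"
| "exec r (I # Is) =
     (case exec_instr r I of None \<Rightarrow> None | Some z \<Rightarrow> exec (r @ [z]) Is)"

text \<open>The second component of a program lists the registers that form the output.\<close>

type_synonym slp = "instr list \<times> nat list"

definition run :: "slp \<Rightarrow> complex list \<Rightarrow> complex list option" where
  "run P inp =
     (case exec inp (fst P) of
        None \<Rightarrow> None
      | Some r \<Rightarrow> if \<forall>a \<in> set (snd P). a < length r then Some (map (\<lambda>a. r ! a) (snd P)) else None)"

fun is_multiplicative :: "instr \<Rightarrow> bool" where
  "is_multiplicative (CMul a b) = True"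
| "is_multiplicative (CDiv a b) = True"
| "is_multiplicative I = False"

fun is_additive :: "instr \<Rightarrow> bool" where
  "is_additive (CAdd a b) = True"
| "is_additive (CSub a b) = True"
| "is_additive I = False"

definition mult_cost :: "slp \<Rightarrow> nat" where
  "mult_cost P = length (filter is_multiplicative (fst P))"

text \<open>Conjugation and loading a constant are not arithmetic operations and are free.\<close>

definition arith_cost :: "slp \<Rightarrow> nat" where
  "arith_cost P = length (filter (\<lambda>I. is_multiplicative I \<or> is_additive I) (fst P))"

definition quasilinear_cost :: "(nat \<Rightarrow> slp) \<Rightarrow> bool" where
  "quasilinear_cost P \<longleftrightarrow> (\<lambda>n. real (arith_cost (P n))) \<in> O(\<lambda>n. real n * ln (real n))"

definition fast_matvec :: "(nat \<Rightarrow> complex mat) \<Rightarrow> bool" where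
  "fast_matvec M \<longleftrightarrow>
     (\<exists>P. quasilinear_cost P \<and>
          (\<forall>n. \<forall>v \<in> carrier_vec n. run (P n) (list_of_vec v) = Some (list_of_vec (M n *\<^sub>v v))))"


section \<open>Matrices\<close>

definition unitary_mat :: "complex mat \<Rightarrow> bool" where
  "unitary_mat U \<longleftrightarrow>
     square_mat U \<and> inverts_mat U (mat_adjoint U) \<and> inverts_mat (mat_adjoint U) U"

definition commutator :: "complex mat \<Rightarrow> complex mat \<Rightarrow> complex mat" where
  "commutator A W = A * W - W * A"

definition dyadic_sum ::
  "nat \<Rightarrow> nat \<Rightarrow> (nat \<Rightarrow> complex vec) \<Rightarrow> (nat \<Rightarrow> complex vec) \<Rightarrow> complex mat" where
  "dyadic_sum n r x y = mat n n (\<lambda>(i, j). \<Sum>k<r. x k $ i * cnj (y k $ j))"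

definition poly_mat :: "complex poly \<Rightarrow> complex mat \<Rightarrow> complex mat" where
  "poly_mat p W = mat (dim_row W) (dim_row W)
     (\<lambda>(i, j). \<Sum>k\<le>degree p. coeff p k * (W ^\<^sub>m k) $$ (i, j))"

definition generated_algebra :: "complex mat \<Rightarrow> complex mat set" where
  "generated_algebra W = range (\<lambda>p. poly_mat p W)"

definition diagonalized_by :: "complex mat \<Rightarrow> nat \<Rightarrow> (nat \<Rightarrow> complex) \<Rightarrow> complex mat" where
  "diagonalized_by U n \<theta> = U * mat_diag n \<theta> * mat_adjoint U"

definition pairwise_distinct :: "nat \<Rightarrow> (nat \<Rightarrow> complex) \<Rightarrow> bool" where
  "pairwise_distinct n lam \<longleftrightarrow> (\<forall>i<n. \<forall>k<n. lam i = lam k \<longleftrightarrow> i = k)"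

definition vectors_to_list :: "nat \<Rightarrow> (nat \<Rightarrow> complex vec) \<Rightarrow> complex list" where
  "vectors_to_list r x = concat (map (\<lambda>k. list_of_vec (x k)) [0..<r])"

end

theory Submission
  imports Defs
begin

text \<open>
  For \<open>W = U D U\<^sup>*\<close> and \<open>B = U\<^sup>* A U\<close> one has \<open>U\<^sup>* [A, W] U = B D - D B\<close>, whose \<open>(i, j)\<close> entry is
  \<open>(\<lambda>\<^sub>j - \<lambda>\<^sub>i) B\<^sub>i\<^sub>j\<close>. On the other hand \<open>U\<^sup>* [A, W] U\<close> is the dyadic sum of the \<open>2 \<rho>\<close> vectors
  \<open>U\<^sup>* x\<^sub>k\<close> and \<open>U\<^sup>* y\<^sub>k\<close>, which are the precomputed data; an off-diagonal entry of \<open>B\<close> therefore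
  costs \<open>\<rho>\<close> products and one division by \<open>\<lambda>\<^sub>j - \<lambda>\<^sub>i\<close>. That \<open>W\<close> generates all of
  \<open>{U diag(\<theta>) U\<^sup>*}\<close> is polynomial interpolation at the distinct eigenvalues.
\<close>

section \<open>Relocating straight-line programs\<close>

fun map_instr :: "(nat \<Rightarrow> nat) \<Rightarrow> instr \<Rightarrow> instr" where
  "map_instr f (CConst c) = CConst c"
| "map_instr f (CConj a) = CConj (f a)"
| "map_instr f (CAdd a b) = CAdd (f a) (f b)"
| "map_instr f (CSub a b) = CSub (f a) (f b)"
| "map_instr f (CMul a b) = CMul (f a) (f b)"
| "map_instr f (CDiv a b) = CDiv (f a) (f b)"

lemma is_multiplicative_map_instr [simp]: "is_multiplicative (map_instr f I) = is_multiplicative I"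
  by (cases I) auto

lemma is_additive_map_instr [simp]: "is_additive (map_instr f I) = is_additive I"
  by (cases I) auto

lemma exec_append: "exec r (Is @ Js) = Option.bind (exec r Is) (\<lambda>r'. exec r' Js)"
  by (induction Is arbitrary: r) (auto split: option.splits)

lemma exec_extends:
  assumes "exec r Is = Some r'"
  shows "\<exists>zs. r' = r @ zs \<and> length zs = length Is"
  using assms
proof (induction Is arbitrary: r)
  case (Cons I Is)
  then obtain z where "exec (r @ [z]) Is = Some r'"
    by (auto split: option.splits)
  from Cons.IH[OF this] obtain zs where "r' = (r @ [z]) @ zs" "length zs = length Is"
    by blast
  then show ?case
    by (intro exI[of _ "z # zs"]) simp
qed simp

lemma exec_instr_map_instr:
  assumes "exec_instr r I = Some z"
    and "\<And>a. a < length r \<Longrightarrow> f a < length R \<and> R ! f a = r ! a"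
  shows "exec_instr R (map_instr f I) = Some z"
  using assms by (cases I) (auto split: if_splits)

text \<open>Each instruction appends exactly one register, so once the existing registers are
  matched, the renaming is forced to be a shift on the fresh ones. Appending the same value to
  \<open>r\<close> and \<open>R\<close> preserves both conditions on \<open>f\<close>, which drives
  the induction.\<close>

lemma exec_map_instr:
  assumes "exec r Is = Some (r @ zs)"
    and "\<And>a. a < length r \<Longrightarrow> f a < length R \<and> R ! f a = r ! a"
    and "\<And>a. length r \<le> a \<Longrightarrow> f a = length R + (a - length r)"
  shows "exec R (map (map_instr f) Is) = Some (R @ zs)"
  using assms
proof (induction Is arbitrary: r R zs)
  case (Cons I Is)
  then obtain z where z: "exec_instr r I = Some z" and ex: "exec (r @ [z]) Is = Some (r @ zs)"
    by (auto split: option.splits)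
  from exec_extends[OF ex] obtain zs' where zs': "zs = z # zs'"
    by auto
  have "exec (R @ [z]) (map (map_instr f) Is) = Some ((R @ [z]) @ zs')"
  proof (rule Cons.IH)
    show "exec (r @ [z]) Is = Some ((r @ [z]) @ zs')"
      using ex zs' by simp
    show "f a < length (R @ [z]) \<and> (R @ [z]) ! f a = (r @ [z]) ! a" if "a < length (r @ [z])" for a
      using that Cons.prems(2)[of a] Cons.prems(3)[of a]
      by (cases "a < length r") (auto simp: nth_append)
    show "f a = length (R @ [z]) + (a - length (r @ [z]))" if "length (r @ [z]) \<le> a" for a
      using that Cons.prems(3)[of a] by auto
  qed
  then show ?case
    using exec_instr_map_instr[OF z, of f R] Cons.prems(2) zs' by simp
qed simp

section \<open>Running one program on many consecutive blocks\<close>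

lemma length_concat_blocks:
  assumes "\<And>b. b < m \<Longrightarrow> length (w b) = s"
  shows "length (concat (map w [0..<m])) = m * s"
  using assms by (induction m) auto

lemma nth_concat_blocks:
  assumes "\<And>b. b < m \<Longrightarrow> length (w b) = s" and "b < m" and "a < s"
  shows "concat (map w [0..<m]) ! (b * s + a) = w b ! a"
  using assms
proof (induction m)
  case (Suc m)
  have len: "length (concat (map w [0..<m])) = m * s"
    using Suc.prems(1) by (intro length_concat_blocks) auto
  show ?case
  proof (cases "b = m")
    case True
    then show ?thesis using len by (simp add: nth_append)
  next
    case False
    then have "b < m" using Suc.prems(2) by simp
    have "b * s + a < Suc b * s"
      using Suc.prems(3) by simp
    also have "\<dots> \<le> m * s"
      using \<open>b < m\<close> by (intro mult_le_mono1) simp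
    finally show ?thesis
      using Suc.IH Suc.prems \<open>b < m\<close> len by (simp add: nth_append)
  qed
qed simp

lemma block_index_less:
  assumes "b < m" "a < s"
  shows "b * s + a < m * (s::nat)"
proof -
  have "b * s + a < Suc b * s" using assms by simp
  also have "\<dots> \<le> m * s" using assms by (intro mult_le_mono1) simp
  finally show ?thesis .
qed

text \<open>
  The input of the relocated programs consists of \<open>l\<close> leading registers followed by \<open>m\<close> blocks
  of length \<open>s\<close>; \<open>block_reg l m s t b\<close> renames the registers of the \<open>b\<close>-th copy of a program
  with \<open>s\<close> inputs and \<open>t\<close> instructions.
\<close>

definition block_reg :: "nat \<Rightarrow> nat \<Rightarrow> nat \<Rightarrow> nat \<Rightarrow> nat \<Rightarrow> nat \<Rightarrow> nat" where
  "block_reg l m s t b a =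
     (if a < s then l + (b * s + a) else l + m * s + b * t + (a - s))"

text \<open>The copies run one after another, each with its own working registers. The offset
  \<open>l\<close> leaves room for the eigenvalues, which precede the vectors in the input.\<close>

definition batch :: "nat \<Rightarrow> nat \<Rightarrow> nat \<Rightarrow> slp \<Rightarrow> slp" where
  "batch l m s P =
     (concat (map (\<lambda>b. map (map_instr (block_reg l m s (length (fst P)) b)) (fst P)) [0..<m]),
      concat (map (\<lambda>b. map (block_reg l m s (length (fst P)) b) (snd P)) [0..<m]))"

lemma arith_cost_batch: "arith_cost (batch l m s P) = m * arith_cost P"
proof -
  let ?c = "\<lambda>Is. length (filter (\<lambda>I. is_multiplicative I \<or> is_additive I) Is)"
  have "?c (concat (map (\<lambda>b. map (map_instr (f b)) Is) [0..<m])) = m * ?c Is" for f Is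
    by (induction m) (auto simp: filter_map o_def)
  then show ?thesis
    by (simp add: arith_cost_def batch_def)
qed

text \<open>Execution only appends, so every input block is still intact when its copy starts,
  whatever the earlier copies have produced; \<open>exec_map_instr\<close> then applies to each copy
  in turn.\<close>

lemma run_batch:
  assumes len: "length r = l" "\<And>b. b < m \<Longrightarrow> length (v b) = s"
    and run: "\<And>b. b < m \<Longrightarrow> run P (v b) = Some (w b)"
  shows "run (batch l m s P) (r @ concat (map v [0..<m])) = Some (concat (map w [0..<m]))"
proof -
  let ?f = "block_reg l m s (length (fst P))"
  let ?R = "r @ concat (map v [0..<m])"
  have "\<exists>zs. exec (v b) (fst P) = Some (v b @ zs) \<and> length zs = length (fst P) \<and>
      (\<forall>a\<in>set (snd P). a < s + length zs) \<and> w b = map ((!) (v b @ zs)) (snd P)" if b: "b < m" for b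
  proof -
    obtain r' where r': "exec (v b) (fst P) = Some r'" "\<forall>a\<in>set (snd P). a < length r'"
        "w b = map ((!) r') (snd P)"
      using run[OF b] by (auto simp: run_def split: option.splits if_splits)
    with exec_extends[OF r'(1)] len(2)[OF b] show ?thesis by auto
  qed
  then obtain zs where zs: "\<And>b. b < m \<Longrightarrow> exec (v b) (fst P) = Some (v b @ zs b)"
      "\<And>b. b < m \<Longrightarrow> length (zs b) = length (fst P)"
      "\<And>b a. b < m \<Longrightarrow> a \<in> set (snd P) \<Longrightarrow> a < s + length (fst P)"
      "\<And>b. b < m \<Longrightarrow> w b = map ((!) (v b @ zs b)) (snd P)"
    by metis
  have lenR: "length ?R = l + m * s"
    using len by (simp add: length_concat_blocks[of m v s])
  have nthR: "?f b a < length ?R \<and> ?R ! ?f b a = v b ! a" if "b < m" "a < s" for a b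
    using that lenR len block_index_less[OF that] nth_concat_blocks[of m v s b a]
    by (auto simp: block_reg_def nth_append)
  have nth_ext: "?f b a < length (?R @ t) \<and> (?R @ t) ! ?f b a = v b ! a" if "b < m" "a < s" for a b t
    using nthR[OF that] by (simp only: nth_append_left length_append) simp
  have ex: "exec ?R (concat (map (\<lambda>b. map (map_instr (?f b)) (fst P)) [0..<k]))
      = Some (?R @ concat (map zs [0..<k]))" if "k \<le> m" for k
    using that
  proof (induction k)
    case (Suc k)
    let ?S = "?R @ concat (map zs [0..<k])"
    have lenS: "length ?S = l + m * s + k * length (fst P)"
      using lenR zs(2) Suc.prems length_concat_blocks[of k zs "length (fst P)"] by simp
    have "exec ?S (map (map_instr (?f k)) (fst P)) = Some (?S @ zs k)"
    proof (rule exec_map_instr)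
      show "exec (v k) (fst P) = Some (v k @ zs k)"
        using zs(1) Suc.prems by simp
      show "?f k a < length ?S \<and> ?S ! ?f k a = v k ! a" if "a < length (v k)" for a
        using nth_ext[of k a] that Suc.prems len(2)[of k] by simp
      show "?f k a = length ?S + (a - length (v k))" if "length (v k) \<le> a" for a
        using that Suc.prems len(2)[of k] lenS by (simp add: block_reg_def)
    qed
    then show ?case
      using Suc by (simp add: exec_append)
  qed simp
  let ?F = "?R @ concat (map zs [0..<m])"
  have lenF: "length ?F = l + m * s + m * length (fst P)"
    using lenR zs(2) length_concat_blocks[of m zs "length (fst P)"] by simp
  \<comment> \<open>An output register may be an input of its copy (\<open>a < s\<close>) or one of
    its computed registers; the two lie in different regions of the final list.\<close>
  have out: "?f b a < length ?F \<and> ?F ! ?f b a = (v b @ zs b) ! a" if "b < m" "a \<in> set (snd P)" for a b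
  proof (cases "a < s")
    case True
    then show ?thesis
      using nth_ext[OF that(1) True] that len(2)[of b] by (simp add: nth_append_left)
  next
    case False
    then have "a - s < length (fst P)"
      using zs(3)[OF that] by simp
    then have "b * length (fst P) + (a - s) < m * length (fst P)"
        "concat (map zs [0..<m]) ! (b * length (fst P) + (a - s)) = zs b ! (a - s)"
      using that(1) zs(2) by (auto intro!: block_index_less nth_concat_blocks)
    moreover have "?f b a = length ?R + (b * length (fst P) + (a - s))"
      using False lenR by (simp add: block_reg_def)
    ultimately show ?thesis
      using lenF lenR False len(2)[OF that(1)] by (simp only: nth_append) auto
  qed
  have "map ((!) ?F) (concat (map (\<lambda>b. map (?f b) (snd P)) [0..<m])) = concat (map w [0..<m])"
    unfolding map_concat map_map o_def
    by (intro arg_cong[of _ _ concat] map_cong refl) (use out zs(4) in auto)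
  moreover have "\<forall>a\<in>set (snd (batch l m s P)). a < length ?F"
    using out by (auto simp: batch_def)
  ultimately show ?thesis
    using ex[OF order.refl] by (simp add: run_def batch_def)
qed


section \<open>A program for one off-diagonal entry\<close>

text \<open>
  On \<open>L\<close> input registers, \<open>acc_instrs L f g k\<close> leaves in register \<open>L + 3 * k\<close> the partial sum of
  the products of register \<open>f q\<close> with the conjugate of register \<open>g q\<close>.
\<close>

definition acc_instrs :: "nat \<Rightarrow> (nat \<Rightarrow> nat) \<Rightarrow> (nat \<Rightarrow> nat) \<Rightarrow> nat \<Rightarrow> instr list" where
  "acc_instrs L f g k =
     CConst 0 # concat (map (\<lambda>q. [CConj (g q), CMul (f q) (L + 3 * q + 1),
       CAdd (L + 3 * q) (L + 3 * q + 2)]) [0..<k])"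

text \<open>The matrix indices \<open>i\<close> and \<open>j\<close> double as register numbers,
  because the eigenvalues stand at the front of the input of a query. The difference goes to
  register \<open>L + 3 * k + 1\<close> and the quotient to the next one.\<close>

definition quotient_slp ::
  "nat \<Rightarrow> (nat \<Rightarrow> nat) \<Rightarrow> (nat \<Rightarrow> nat) \<Rightarrow> nat \<Rightarrow> nat \<Rightarrow> nat \<Rightarrow> slp" where
  "quotient_slp L f g k i j =
     (acc_instrs L f g k @ [CSub j i, CDiv (L + 3 * k) (L + 3 * k + 1)], [L + 3 * k + 2])"

lemma mult_cost_quotient_slp: "mult_cost (quotient_slp L f g k i j) = k + 1"
proof -
  have "length (filter is_multiplicative (acc_instrs L f g k)) = k"
    unfolding acc_instrs_def by (induction k) auto
  then show ?thesis
    by (simp add: mult_cost_def quotient_slp_def)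
qed

text \<open>Register \<open>L\<close> starts with zero. Round \<open>q\<close> writes the conjugate,
  the product and the new partial sum to the registers \<open>L + 3 * q + 1\<close> to
  \<open>L + 3 * q + 3\<close>, so one multiplication is spent per round.\<close>

lemma exec_acc_instrs:
  assumes "length r = L" and "\<And>q. q < k \<Longrightarrow> f q < L \<and> g q < L"
  shows "\<exists>t. exec r (acc_instrs L f g k) = Some (r @ t) \<and> length t = 3 * k + 1 \<and>
           t ! (3 * k) = (\<Sum>q<k. r ! f q * cnj (r ! g q))"
  using assms(2)
proof (induction k)
  case (Suc k)
  let ?S = "\<Sum>q<k. r ! f q * cnj (r ! g q)"
  obtain t where t: "exec r (acc_instrs L f g k) = Some (r @ t)" "length t = 3 * k + 1"
      "t ! (3 * k) = ?S"
    using Suc by auto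
  let ?y = "cnj (r ! g k)"
  let ?u = "t @ [?y, r ! f k * ?y, ?S + r ! f k * ?y]"
  have "exec r (acc_instrs L f g (Suc k)) = exec (r @ t) [CConj (g k), CMul (f k) (L + 3 * k + 1),
       CAdd (L + 3 * k) (L + 3 * k + 2)]"
    using t(1) by (simp add: acc_instrs_def exec_append del: exec.simps(2) flip: append_Cons)
  also have "\<dots> = Some (r @ ?u)"
    using assms(1) t Suc.prems[of k] by (simp add: nth_append)
  finally show ?case
    using t(2) by (intro exI[of _ ?u]) (simp add: nth_append)
qed (simp add: acc_instrs_def)

lemma run_quotient_slp:
  assumes "length r = L" and "\<And>q. q < k \<Longrightarrow> f q < L \<and> g q < L"
    and "i < L" "j < L" "r ! i \<noteq> r ! j"
  shows "run (quotient_slp L f g k i j) r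
           = Some [(\<Sum>q<k. r ! f q * cnj (r ! g q)) / (r ! j - r ! i)]"
proof -
  obtain t where t: "exec r (acc_instrs L f g k) = Some (r @ t)" "length t = 3 * k + 1"
      "t ! (3 * k) = (\<Sum>q<k. r ! f q * cnj (r ! g q))"
    using exec_acc_instrs[OF assms(1), of k f g] assms(2) by blast
  then show ?thesis
    using assms by (simp add: run_def quotient_slp_def exec_append nth_append)
qed


section \<open>Conjugation by the unitary eigenvector matrix\<close>

lemma mat_adjoint_carrier: "A \<in> carrier_mat m n \<Longrightarrow> mat_adjoint A \<in> carrier_mat n m"
  by (auto simp: mat_adjoint_def)

lemma index_mat_adjoint:
  "A \<in> carrier_mat m n \<Longrightarrow> i < n \<Longrightarrow> j < m \<Longrightarrow> mat_adjoint A $$ (i, j) = cnj (A $$ (j, i))"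
  by (auto simp: mat_adjoint_def mat_of_rows_def)

lemma unitary_matD:
  assumes "unitary_mat U" and "U \<in> carrier_mat n n"
  shows "U * mat_adjoint U = 1\<^sub>m n" and "mat_adjoint U * U = 1\<^sub>m n"
  using assms mat_adjoint_carrier[OF assms(2)] by (auto simp: unitary_mat_def inverts_mat_def)

lemma index_diagonalized_by:
  assumes "U \<in> carrier_mat n n" "i < n" "j < n"
  shows "diagonalized_by U n \<theta> $$ (i, j) = (\<Sum>l<n. U $$ (i, l) * \<theta> l * mat_adjoint U $$ (l, j))"
  using assms mat_adjoint_carrier[OF assms(1)]
  by (simp add: diagonalized_by_def mat_diag_mult_right scalar_prod_def atLeast0LessThan)

lemma diagonalized_by_carrier [simp]:
  "U \<in> carrier_mat n n \<Longrightarrow> diagonalized_by U n \<theta> \<in> carrier_mat n n"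
  unfolding diagonalized_by_def
  by (intro mult_carrier_mat[of _ n n] mat_adjoint_carrier mat_diag_dim) auto

lemma diagonalized_by_cong:
  assumes "U \<in> carrier_mat n n" and "\<And>l. l < n \<Longrightarrow> \<theta> l = \<theta>' l"
  shows "diagonalized_by U n \<theta> = diagonalized_by U n \<theta>'"
proof -
  have "mat_diag n \<theta> = mat_diag n \<theta>'"
    using assms(2) by (auto simp: mat_diag_def)
  then show ?thesis by (simp add: diagonalized_by_def)
qed

section \<open>Polynomials in a diagonalized matrix and interpolation\<close>

lemma mat_diag_pow: "mat_diag n \<theta> ^\<^sub>m k = mat_diag n (\<lambda>l. \<theta> l ^ k)"
proof (induction k)
  case 0
  have "dim_row (mat_diag n \<theta>) = n" by (simp add: mat_diag_def)
  then show ?case by simp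
qed (simp add: power_Suc2 del: power_Suc)

lemma diagonalized_by_pow:
  assumes "unitary_mat U" and U: "U \<in> carrier_mat n n"
  shows "diagonalized_by U n \<theta> ^\<^sub>m k = diagonalized_by U n (\<lambda>l. \<theta> l ^ k)"
proof -
  have "similar_mat_wit (diagonalized_by U n \<theta>) (mat_diag n \<theta>) U (mat_adjoint U)"
    using unitary_matD[OF assms] U mat_adjoint_carrier[OF U] diagonalized_by_carrier[OF U, of \<theta>]
    by (auto simp: similar_mat_wit_def Let_def diagonalized_by_def)
  from similar_mat_wit_pow_id[OF this, of k] show ?thesis
    by (simp add: mat_diag_pow diagonalized_by_def)
qed

text \<open>Powers of the matrix act on the diagonal alone; since \<open>poly_mat\<close> is defined
  entrywise, exchanging the sum over exponents with the sum over eigenvalues gives the polynomial at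
  each eigenvalue.\<close>

lemma poly_mat_diagonalized_by:
  assumes "unitary_mat U" and U: "U \<in> carrier_mat n n"
  shows "poly_mat p (diagonalized_by U n \<theta>) = diagonalized_by U n (\<lambda>l. poly p (\<theta> l))"
proof (rule eq_matI)
  have dims: "dim_row (diagonalized_by U n \<theta>') = n" "dim_col (diagonalized_by U n \<theta>') = n" for \<theta>'
    using diagonalized_by_carrier[OF U, of \<theta>'] by auto
  then show "dim_row (poly_mat p (diagonalized_by U n \<theta>)) = dim_row (diagonalized_by U n (\<lambda>l. poly p (\<theta> l)))"
    "dim_col (poly_mat p (diagonalized_by U n \<theta>)) = dim_col (diagonalized_by U n (\<lambda>l. poly p (\<theta> l)))"
    by (simp_all add: poly_mat_def)
  fix i j
  assume "i < dim_row (diagonalized_by U n (\<lambda>l. poly p (\<theta> l)))"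
    "j < dim_col (diagonalized_by U n (\<lambda>l. poly p (\<theta> l)))"
  then have ij: "i < n" "j < n" by (simp_all add: dims)
  then have "poly_mat p (diagonalized_by U n \<theta>) $$ (i, j)
      = (\<Sum>k\<le>degree p. \<Sum>l<n. coeff p k * (U $$ (i, l) * \<theta> l ^ k * mat_adjoint U $$ (l, j)))"
    by (simp add: poly_mat_def dims diagonalized_by_pow[OF assms] index_diagonalized_by[OF U] sum_distrib_left)
  also have "\<dots> = (\<Sum>l<n. \<Sum>k\<le>degree p. coeff p k * (U $$ (i, l) * \<theta> l ^ k * mat_adjoint U $$ (l, j)))"
    by (rule sum.swap)
  also have "\<dots> = diagonalized_by U n (\<lambda>l. poly p (\<theta> l)) $$ (i, j)"
    by (simp add: index_diagonalized_by[OF U ij] poly_altdef sum_distrib_left sum_distrib_right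
        algebra_simps)
  finally show "poly_mat p (diagonalized_by U n \<theta>) $$ (i, j) = diagonalized_by U n (\<lambda>l. poly p (\<theta> l)) $$ (i, j)" .
qed

lemma poly_interpolation_exists:
  fixes x y :: "nat \<Rightarrow> 'a :: field"
  assumes "inj_on x {..<n}"
  shows "\<exists>p. \<forall>l<n. poly p (x l) = y l"
  using assms
proof (induction n)
  case (Suc n)
  then have "inj_on x {..<n}" by (auto simp: inj_on_def)
  then obtain p where p: "\<forall>l<n. poly p (x l) = y l" using Suc.IH by blast
  \<comment> \<open>Newton's step: \<open>q\<close> vanishes at the earlier nodes but not at
    \<open>x n\<close>, so a multiple of it corrects the value at \<open>x n\<close> without
    disturbing the others.\<close>
  define q where "q = (\<Prod>l<n. [:- x l, 1:])"
  have q0: "poly q (x l) = 0" if "l < n" for l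
    using that by (auto simp: q_def poly_prod)
  have "x n \<noteq> x l" if "l < n" for l
    using inj_onD[OF Suc.prems, of n l] that by auto
  then have qn: "poly q (x n) \<noteq> 0"
    by (auto simp: q_def poly_prod)
  show ?case
    using p q0 qn
    by (intro exI[of _ "p + smult ((y n - poly p (x n)) / poly q (x n)) q"]) (auto simp: less_Suc_eq)
qed simp

lemma generated_algebra_diagonalized_by:
  assumes U: "unitary_mat U" "U \<in> carrier_mat n n" and "pairwise_distinct n lam"
  shows "generated_algebra (diagonalized_by U n lam) = range (diagonalized_by U n)"
proof -
  have "\<exists>p. diagonalized_by U n \<theta> = diagonalized_by U n (\<lambda>l. poly p (lam l))" for \<theta>
  proof -
    have "inj_on lam {..<n}"
      using assms(3) by (auto simp: pairwise_distinct_def inj_on_def)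
    then obtain p where "\<forall>l<n. poly p (lam l) = \<theta> l"
      using poly_interpolation_exists by blast
    then show ?thesis
      by (intro exI[of _ p] diagonalized_by_cong U(2)) auto
  qed
  then show ?thesis
    by (auto simp: generated_algebra_def poly_mat_diagonalized_by[OF U] image_iff)
qed

section \<open>The commutator in the eigenvector basis\<close>

lemma conj_mult_similar:
  fixes A :: "'a :: semiring_1 mat"
  assumes VU: "V * U = 1\<^sub>m n"
    and carrier: "A \<in> carrier_mat n n" "U \<in> carrier_mat n n" "V \<in> carrier_mat n n" "D \<in> carrier_mat n n"
  shows "V * (A * (U * D * V)) * U = V * A * U * D"
    and "V * (U * D * V * A) * U = D * (V * A * U)"
proof -
  note closed = mult_carrier_mat[of _ n n _ n]
  have assoc: "X * Y * Z = X * (Y * Z)"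
    if "X \<in> carrier_mat n n" "Y \<in> carrier_mat n n" "Z \<in> carrier_mat n n" for X Y Z :: "'a mat"
    using that by (rule assoc_mult_mat)
  \<comment> \<open>With all products associated to the right, this rewrite removes every inner
    \<open>V * U\<close>.\<close>
  have cancel: "V * (U * X) = X" if "X \<in> carrier_mat n n" for X
    using assoc[OF carrier(3,2) that] left_mult_one_mat[OF that] VU by simp
  show "V * (A * (U * D * V)) * U = V * A * U * D" "V * (U * D * V * A) * U = D * (V * A * U)"
    by (simp_all add: assoc cancel carrier closed VU right_mult_one_mat[of _ n n])
qed

lemma conj_diff_mat:
  fixes A :: "'a :: ring mat"
  assumes "A \<in> carrier_mat n n" "B \<in> carrier_mat n n" "U \<in> carrier_mat n n" "V \<in> carrier_mat n n"
  shows "V * (A - B) * U = V * A * U - V * B * U"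
  using assms mult_minus_distrib_mat[of V n n A n B] minus_mult_distrib_mat[of "V * A" n n "V * B" U n]
  by simp

text \<open>A diagonal factor scales columns when it stands on the right and rows when it stands on
  the left, which yields the factors \<open>lam j\<close> and \<open>lam i\<close>.\<close>

lemma index_conj_commutator:
  assumes unitary: "unitary_mat U" and U: "U \<in> carrier_mat n n" and A: "A \<in> carrier_mat n n"
    and ij: "i < n" "j < n"
  shows "(mat_adjoint U * commutator A (diagonalized_by U n lam) * U) $$ (i, j)
           = (lam j - lam i) * (mat_adjoint U * A * U) $$ (i, j)"
proof -
  let ?V = "mat_adjoint U" and ?D = "mat_diag n lam"
  let ?B = "?V * A * U"
  have V: "?V \<in> carrier_mat n n" and D: "?D \<in> carrier_mat n n" using mat_adjoint_carrier[OF U] by auto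
  note c = U V D A mult_carrier_mat[of _ n n _ n]
  have "?V * commutator A (diagonalized_by U n lam) * U
      = ?V * (A * (U * ?D * ?V)) * U - ?V * (U * ?D * ?V * A) * U"
    unfolding commutator_def diagonalized_by_def
    by (rule conj_diff_mat[of _ n]) (intro mult_carrier_mat[of _ n n _ n] U V A D)+
  also have "\<dots> = ?B * ?D - ?D * ?B" by (simp only: conj_mult_similar[OF unitary_matD(2)[OF unitary U] A U V D])
  also have "\<dots> $$ (i, j) = (lam j - lam i) * ?B $$ (i, j)"
    using c ij by (simp add: mat_diag_mult_left[of _ n n] mat_diag_mult_right[of _ n n] algebra_simps
        del: index_mult_mat(1))
  finally show ?thesis .
qed

text \<open>Since \<open>y\<^sub>k\<^sup>* U = (U\<^sup>* y\<^sub>k)\<^sup>*\<close>, the right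
  factor is absorbed into \<open>y\<close>. Both families are thus transformed by the same matrix,
  and one fast program serves for all of them.\<close>

lemma conj_dyadic_sum:
  assumes U: "U \<in> carrier_mat n n"
    and xy: "\<And>k. k < r \<Longrightarrow> x k \<in> carrier_vec n \<and> y k \<in> carrier_vec n"
  shows "mat_adjoint U * dyadic_sum n r x y * U
           = dyadic_sum n r (\<lambda>k. mat_adjoint U *\<^sub>v x k) (\<lambda>k. mat_adjoint U *\<^sub>v y k)"
proof (rule eq_matI)
  let ?V = "mat_adjoint U"
  have V: "?V \<in> carrier_mat n n" by (rule mat_adjoint_carrier[OF U])
  fix i j
  assume "i < dim_row (dyadic_sum n r (\<lambda>k. ?V *\<^sub>v x k) (\<lambda>k. ?V *\<^sub>v y k))"
    "j < dim_col (dyadic_sum n r (\<lambda>k. ?V *\<^sub>v x k) (\<lambda>k. ?V *\<^sub>v y k))"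
  then have ij: "i < n" "j < n" by (simp_all add: dyadic_sum_def)
  have mv: "(?V *\<^sub>v z) $ l = (\<Sum>a<n. ?V $$ (l, a) * z $ a)" if "z \<in> carrier_vec n" "l < n" for z l
    using that V by (simp add: scalar_prod_def atLeast0LessThan)
  have "(?V * dyadic_sum n r x y * U) $$ (i, j)
      = (\<Sum>b<n. \<Sum>a<n. \<Sum>k<r. ?V $$ (i, a) * x k $ a * (cnj (y k $ b) * U $$ (b, j)))"
    using ij U V
    by (simp add: dyadic_sum_def scalar_prod_def atLeast0LessThan sum_distrib_left sum_distrib_right
        algebra_simps)
  \<comment> \<open>Two exchanges bring the sum over \<open>k\<close> outermost; the double sum
    inside then factors.\<close>
  also have "\<dots> = (\<Sum>b<n. \<Sum>k<r. \<Sum>a<n. ?V $$ (i, a) * x k $ a * (cnj (y k $ b) * U $$ (b, j)))"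
    by (intro sum.cong refl sum.swap)
  also have "\<dots> = (\<Sum>k<r. \<Sum>b<n. \<Sum>a<n. ?V $$ (i, a) * x k $ a * (cnj (y k $ b) * U $$ (b, j)))"
    by (rule sum.swap)
  also have "\<dots> = (\<Sum>k<r. (?V *\<^sub>v x k) $ i * cnj ((?V *\<^sub>v y k) $ j))"
    using ij xy U
    by (intro sum.cong refl)
      (simp add: mv index_mat_adjoint sum_distrib_left sum_distrib_right algebra_simps)
  finally show "(?V * dyadic_sum n r x y * U) $$ (i, j)
      = dyadic_sum n r (\<lambda>k. ?V *\<^sub>v x k) (\<lambda>k. ?V *\<^sub>v y k) $$ (i, j)"
    using ij by (simp add: dyadic_sum_def)
qed (use U mat_adjoint_carrier[OF U] in \<open>auto simp: dyadic_sum_def\<close>)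

text \<open>Presents both families as one sequence of \<open>2 * r\<close> blocks, the form of input
  that \<open>run_batch\<close> expects.\<close>

lemma vectors_to_list_append:
  "vectors_to_list r x @ vectors_to_list r y
     = concat (map (\<lambda>b. list_of_vec (if b < r then x b else y (b - r))) [0..<2 * r])"
proof -
  have "[0..<2 * r] = [0..<r] @ [r..<r + r]"
    using upt_add_eq_append[of 0 r r] by (simp add: mult_2)
  also have "[r..<r + r] = map (\<lambda>b. b + r) [0..<r]"
    by (simp add: map_add_upt)
  finally show ?thesis
    by (auto simp: vectors_to_list_def o_def intro!: arg_cong[of _ _ concat])
qed

theorem theorem4p1:
  fixes U :: "nat \<Rightarrow> complex mat" and \<rho> :: "nat \<Rightarrow> nat"
  assumes U_carrier: "\<And>n. U n \<in> carrier_mat n n"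
    and U_unitary: "\<And>n. unitary_mat (U n)"
    and U_fast: "fast_matvec U"
    and U_adjoint_fast: "fast_matvec (\<lambda>n. mat_adjoint (U n))"
    and \<rho>_bounded: "\<exists>R. \<forall>n. \<rho> n \<le> R"
  shows
    "(\<forall>n lam. pairwise_distinct n lam \<longrightarrow>
        generated_algebra (diagonalized_by (U n) n lam) = range (diagonalized_by (U n) n)) \<and>
     (\<exists>(prep :: nat \<Rightarrow> slp) (query :: nat \<Rightarrow> nat \<Rightarrow> nat \<Rightarrow> slp)
        (recover :: nat \<Rightarrow> complex list \<Rightarrow> complex mat).
        quasilinear_cost prep \<and>
        (\<forall>n. \<forall>i<n. \<forall>j<n. i \<noteq> j \<longrightarrow> mult_cost (query n i j) = \<rho> n + 1) \<and>
        (\<forall>n lam W A x y.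
           W = diagonalized_by (U n) n lam \<longrightarrow>
           pairwise_distinct n lam \<longrightarrow>
           A \<in> carrier_mat n n \<longrightarrow>
           vec_space.rank n (commutator A W) = \<rho> n \<longrightarrow>
           (\<forall>k<\<rho> n. x k \<in> carrier_vec n \<and> y k \<in> carrier_vec n) \<longrightarrow>
           commutator A W = dyadic_sum n (\<rho> n) x y \<longrightarrow>
           (\<exists>data.
              run (prep n) (map lam [0..<n] @ vectors_to_list (\<rho> n) x @ vectors_to_list (\<rho> n) y)
                = Some data \<and>
              recover n data = mat_adjoint (U n) * commutator A W * U n \<and>
              (\<forall>i<n. \<forall>j<n. i \<noteq> j \<longrightarrow>
                 run (query n i j) (map lam [0..<n] @ data)
                   = Some [(mat_adjoint (U n) * A * U n) $$ (i, j)]))))"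
proof (intro conjI allI impI)
  show "generated_algebra (diagonalized_by (U n) n lam) = range (diagonalized_by (U n) n)"
    if "pairwise_distinct n lam" for n lam
    using generated_algebra_diagonalized_by[OF U_unitary U_carrier that] .
next
  obtain P where P_cost: "quasilinear_cost P"
    and P_run: "\<And>n v. v \<in> carrier_vec n \<Longrightarrow>
      run (P n) (list_of_vec v) = Some (list_of_vec (mat_adjoint (U n) *\<^sub>v v))"
    using U_adjoint_fast unfolding fast_matvec_def by blast
  obtain R where R: "\<And>n. \<rho> n \<le> R" using \<rho>_bounded by blast
  define prep where "prep n = batch n (2 * \<rho> n) n (P n)" for n
  \<comment> \<open>After the \<open>n\<close> eigenvalues, block \<open>k\<close> of the data is
    the transform of \<open>x k\<close> and block \<open>\<rho> n + k\<close> that of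
    \<open>y k\<close>; the two register maps select component \<open>i\<close> of the former and
    component \<open>j\<close> of the latter.\<close>
  define query where "query n i j = quotient_slp (n + 2 * \<rho> n * n)
      (\<lambda>k. n + (k * n + i)) (\<lambda>k. n + ((\<rho> n + k) * n + j)) (\<rho> n) i j" for n i j
  \<comment> \<open>This function sees only \<open>n\<close> and the data, so its correctness shows
    that the data determine the conjugated commutator.\<close>
  define recover where "recover n d = mat n n (\<lambda>(i, j).
      \<Sum>k<\<rho> n. d ! (k * n + i) * cnj (d ! ((\<rho> n + k) * n + j)))" for n and d :: "complex list"
  \<comment> \<open>The batch costs \<open>2 * \<rho> n\<close> times as much as \<open>P n\<close>,
    and the uniform bound \<open>R\<close> turns this factor into a constant.\<close>
  have "(\<lambda>n. real (arith_cost (prep n))) \<in> O(\<lambda>n. real (arith_cost (P n)))"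
    by (intro bigoI[of _ "real (2 * R)"] always_eventually allI)
      (simp add: prep_def arith_cost_batch R mult_right_mono)
  then have prep_cost: "quasilinear_cost prep"
    using P_cost unfolding quasilinear_cost_def by (rule landau_o.big.trans)
  have query_cost: "mult_cost (query n i j) = \<rho> n + 1" for n i j
    by (simp add: query_def mult_cost_quotient_slp)
  have correct: "\<exists>d. run (prep n)
        (map lam [0..<n] @ vectors_to_list (\<rho> n) x @ vectors_to_list (\<rho> n) y) = Some d \<and>
      recover n d = mat_adjoint (U n) * commutator A W * U n \<and>
      (\<forall>i<n. \<forall>j<n. i \<noteq> j \<longrightarrow> run (query n i j) (map lam [0..<n] @ d)
         = Some [(mat_adjoint (U n) * A * U n) $$ (i, j)])"
    if W: "W = diagonalized_by (U n) n lam" and lam: "pairwise_distinct n lam"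
      and A: "A \<in> carrier_mat n n"
      and xy: "\<forall>k<\<rho> n. x k \<in> carrier_vec n \<and> y k \<in> carrier_vec n"
      and dyadic: "commutator A W = dyadic_sum n (\<rho> n) x y" for n lam W A x y
  proof -
    let ?V = "mat_adjoint (U n)"
    have V: "?V \<in> carrier_mat n n" by (rule mat_adjoint_carrier[OF U_carrier])
    define v where "v b = (if b < \<rho> n then x b else y (b - \<rho> n))" for b
    have v: "v b \<in> carrier_vec n" if "b < 2 * \<rho> n" for b
      using xy that by (auto simp: v_def)
    define d where "d = concat (map (\<lambda>b. list_of_vec (?V *\<^sub>v v b)) [0..<2 * \<rho> n])"
    have "run (prep n) (map lam [0..<n] @ vectors_to_list (\<rho> n) x @ vectors_to_list (\<rho> n) y) = Some d"
      unfolding prep_def vectors_to_list_append d_def v_def[symmetric]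
      using v by (intro run_batch P_run) auto
    moreover have len_d: "length d = 2 * \<rho> n * n"
      unfolding d_def using V by (intro length_concat_blocks) auto
    have nth_d: "d ! (b * n + a) = (?V *\<^sub>v v b) $ a" if "b < 2 * \<rho> n" "a < n" for a b
      unfolding d_def using V that by (subst nth_concat_blocks) auto
    have sum_d: "(\<Sum>k<\<rho> n. d ! (k * n + i) * cnj (d ! ((\<rho> n + k) * n + j)))
        = (\<Sum>k<\<rho> n. (?V *\<^sub>v x k) $ i * cnj ((?V *\<^sub>v y k) $ j))" if "i < n" "j < n" for i j
      using that by (intro sum.cong refl) (simp add: nth_d v_def del: index_mult_mat_vec)
    have C: "?V * commutator A W * U n = dyadic_sum n (\<rho> n) (\<lambda>k. ?V *\<^sub>v x k) (\<lambda>k. ?V *\<^sub>v y k)"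
      unfolding dyadic using xy by (intro conj_dyadic_sum U_carrier) auto
    moreover have rec: "recover n d = ?V * commutator A W * U n"
      unfolding C recover_def dyadic_sum_def
      by (intro eq_matI) (simp_all add: sum_d del: index_mult_mat_vec)
    moreover have "run (query n i j) (map lam [0..<n] @ d) = Some [(?V * A * U n) $$ (i, j)]"
      if ij: "i < n" "j < n" "i \<noteq> j" for i j
    proof -
      let ?r = "map lam [0..<n] @ d"
      have ne: "lam i \<noteq> lam j" using lam ij by (auto simp: pairwise_distinct_def)
      have lt: "k * n + i < 2 * \<rho> n * n" "(\<rho> n + k) * n + j < 2 * \<rho> n * n" if "k < \<rho> n" for k
        using that ij by (intro block_index_less; simp)+
      have "run (query n i j) ?r = Some [(\<Sum>k<\<rho> n. ?r ! (n + (k * n + i)) *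
          cnj (?r ! (n + ((\<rho> n + k) * n + j)))) / (?r ! j - ?r ! i)]"
        unfolding query_def
        by (rule run_quotient_slp) (use lt len_d ij ne in \<open>auto simp: nth_append\<close>)
      \<comment> \<open>The accumulated sum is the entry of the recovered matrix, which equals the
        eigenvalue difference times the wanted entry; distinctness of the eigenvalues permits the
        division.\<close>
      also have "\<dots> = Some [recover n d $$ (i, j) / (lam j - lam i)]"
        using ij by (simp add: nth_append recover_def)
      also have "recover n d $$ (i, j) / (lam j - lam i) = (?V * A * U n) $$ (i, j)"
        unfolding rec W index_conj_commutator[OF U_unitary U_carrier A ij(1,2)] using ne by simp
      finally show ?thesis .
    qed
    ultimately show ?thesis by blast
  qed
  show "\<exists>(prep :: nat \<Rightarrow> slp) (query :: nat \<Rightarrow> nat \<Rightarrow> nat \<Rightarrow> slp)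
        (recover :: nat \<Rightarrow> complex list \<Rightarrow> complex mat).
        quasilinear_cost prep \<and>
        (\<forall>n. \<forall>i<n. \<forall>j<n. i \<noteq> j \<longrightarrow> mult_cost (query n i j) = \<rho> n + 1) \<and>
        (\<forall>n lam W A x y.
           W = diagonalized_by (U n) n lam \<longrightarrow>
           pairwise_distinct n lam \<longrightarrow>
           A \<in> carrier_mat n n \<longrightarrow>
           vec_space.rank n (commutator A W) = \<rho> n \<longrightarrow>
           (\<forall>k<\<rho> n. x k \<in> carrier_vec n \<and> y k \<in> carrier_vec n) \<longrightarrow>
           commutator A W = dyadic_sum n (\<rho> n) x y \<longrightarrow>
           (\<exists>data.
              run (prep n) (map lam [0..<n] @ vectors_to_list (\<rho> n) x @ vectors_to_list (\<rho> n) y)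
                = Some data \<and>
              recover n data = mat_adjoint (U n) * commutator A W * U n \<and>
              (\<forall>i<n. \<forall>j<n. i \<noteq> j \<longrightarrow>
                 run (query n i j) (map lam [0..<n] @ data)
                   = Some [(mat_adjoint (U n) * A * U n) $$ (i, j)])))"
    by (rule exI[of _ prep], rule exI[of _ query], rule exI[of _ recover],
        intro conjI allI impI prep_cost query_cost)
      (rule correct; assumption)
qed

end
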